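(* Let $p\ge 1$, let $f,g:\mathbb{Q}^p\to\mathbb{Q}$ be nonzero linear functions with integer coefficients, let $b$ be a positive integer, and let $S=\{x\in\mathbb{N}^p\mid f(x)\bmod b\le g(x)\}$. Let $w=(w_1,\dots,w_p)\in\mathbb{N}^p\setminus\{0\}$ with $\gcd(w_1,\dots,w_p)=1$. (1) If $g(w)>0$, then the submonoid $\{xw\mid x\in\mathbb{N}\}\cap S$ is isomorphic to a proportionally modular numerical semigroup. (2) If $g(w)=0$, let $u$ be the nonzero element of $\{\lambda w\mid\lambda\in\mathbb{Q}\}\cap\mathbb{N}^p$ closest to the origin satisfying $f(u)\bmod b\le g(u)$. Then $\{\lambda w\mid \lambda\in\mathbb{Q}\}\cap S=\{\lambda u\mid\lambda\in\mathbb{N}\}$, and this submonoid is isomorphic to $\mathbb{N}$.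
   Context: $\mathbb{N}$ is the set of non-negative integers. For an integer $a$ and a positive integer $b$, $a\bmod b\in\{0,\dots,b-1\}$ is the remainder of the Euclidean division of $a$ by $b$. A proportionally modular numerical semigroup is a submonoid of $\mathbb{N}$ of the form $\{x\in\mathbb{N}\mid ax\bmod b\le cx\}$ with $a,b,c$ positive integers. Isomorphism means isomorphism of monoids. *)

theory Defs
  imports "HOL-Analysis.Analysis" "HOL-Algebra.Group"
begin

text \<open>Everything takes place in \<open>rat ^ 'p\<close>, with \<open>CARD('p)\<close> in the role of \<open>p \<ge> 1\<close>;
  vectors of natural numbers are embedded componentwise.\<close>

definition rat_vec :: "nat ^ 'p \<Rightarrow> rat ^ 'p" where
  "rat_vec x = (\<chi> i. of_nat (x $ i))"

definition nat_points :: "(rat ^ 'p) set" where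
  "nat_points = range rat_vec"

definition rat_line :: "rat ^ 'p \<Rightarrow> (rat ^ 'p) set" where
  "rat_line w = {l *s w | l. True}"

text \<open>The library's norm lives on \<open>real ^ 'p\<close>, so Euclidean distances are measured there.\<close>

definition dist_origin :: "rat ^ 'p \<Rightarrow> real" where
  "dist_origin x = dist (\<chi> i. of_rat (x $ i)) (0 :: real ^ 'p)"

definition integer_linear :: "(rat ^ 'p \<Rightarrow> rat) \<Rightarrow> bool" where
  "integer_linear f \<longleftrightarrow>
     Vector_Spaces.linear (*s) (*) f \<and> (\<forall>i. f (axis i 1) \<in> \<int>)"

text \<open>For integer-linear \<open>f\<close> and \<open>x\<close> in \<open>nat_points\<close> the value \<open>f x\<close> is an integer,
  so the floor only changes its type.\<close>

definition mod_ineq :: "(rat ^ 'p \<Rightarrow> rat) \<Rightarrow> (rat ^ 'p \<Rightarrow> rat) \<Rightarrow> int \<Rightarrow> rat ^ 'p \<Rightarrow> bool" where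
  "mod_ineq f g b x \<longleftrightarrow> of_int (\<lfloor>f x\<rfloor> mod b) \<le> g x"

definition mod_semigroup :: "(rat ^ 'p \<Rightarrow> rat) \<Rightarrow> (rat ^ 'p \<Rightarrow> rat) \<Rightarrow> int \<Rightarrow> (rat ^ 'p) set" where
  "mod_semigroup f g b = {x \<in> nat_points. mod_ineq f g b x}"

definition add_mon :: "'a::monoid_add set \<Rightarrow> 'a monoid" where
  "add_mon A = \<lparr>carrier = A, mult = (+), one = 0\<rparr>"

definition prop_modular_numerical_semigroup :: "nat set \<Rightarrow> bool" where
  "prop_modular_numerical_semigroup T \<longleftrightarrow>
     submonoid T (add_mon UNIV) \<and>
     (\<exists>a b c. a > 0 \<and> b > 0 \<and> c > 0 \<and> T = {x. a * x mod b \<le> c * x})"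

end

theory Submission
  imports Defs
begin

text \<open>Restricted to the ray through \<open>w\<close>, the semigroup is governed by the single integer
  inequality \<open>n F mod b \<le> n G\<close> with \<open>F = f w\<close> and \<open>G = g w\<close>
  (\<open>mod_ineq_on_ray\<close>), and \<open>n \<mapsto> n w\<close> is an injective monoid homomorphism,
  so it transports submonoids of \<open>\<nat>\<close> to isomorphic submonoids of the ray
  (\<open>ray_iso\<close>).

  If \<open>G > 0\<close>, the inequality only depends on \<open>F\<close> modulo \<open>b\<close>, so \<open>F\<close> can be
  replaced by a positive representative; this exhibits a proportionally modular numerical
  semigroup.

  If \<open>G = 0\<close>, the inequality says \<open>b dvd n F\<close>, that is, \<open>n\<close> is a multiple of
  \<open>N = b div gcd b F\<close>. Because the entries of \<open>w\<close> have greatest common divisor 1, the natural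
  points of the whole rational line are the natural multiples of \<open>w\<close>
  (\<open>line_nat_points\<close>). Distance from the origin grows strictly with the multiplier, so
  the closest admissible point is \<open>N w\<close>, and its multiples are all the admissible points.\<close>

section \<open>Submonoids of a ray\<close>

lemma submonoid_add_mon_iff:
  "submonoid A (add_mon UNIV) \<longleftrightarrow> 0 \<in> A \<and> (\<forall>x\<in>A. \<forall>y\<in>A. x + y \<in> A)"
  by (auto simp: submonoid_def add_mon_def)

lemma ray_additive:
  "of_nat (m + n) *s v = of_nat m *s v + of_nat n *s (v :: 'a::semiring_1 ^ 'p)"
  by (simp add: vec_eq_iff distrib_right)

lemma ray_inj:
  fixes v :: "rat ^ 'p"
  assumes "v \<noteq> 0"
  shows "inj (\<lambda>n. of_nat n *s v)"
proof (rule injI)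
  fix m n :: nat
  assume eq: "of_nat m *s v = of_nat n *s v"
  from assms obtain i where "v $ i \<noteq> 0"
    by (auto simp: vec_eq_iff)
  moreover have "of_nat m * v $ i = of_nat n * v $ i"
    using eq by (metis vector_smult_component)
  ultimately show "m = n"
    by simp
qed

lemma submonoid_ray:
  fixes v :: "rat ^ 'p"
  assumes "submonoid A (add_mon UNIV)"
  shows "submonoid ((\<lambda>n. of_nat n *s v) ` A) (add_mon UNIV)"
proof -
  have zero: "0 \<in> A" and add: "\<And>x y. x \<in> A \<Longrightarrow> y \<in> A \<Longrightarrow> x + y \<in> A"
    using assms by (auto simp: submonoid_add_mon_iff)
  have "0 \<in> (\<lambda>n. of_nat n *s v) ` A"
    using zero by (rule rev_image_eqI) simp
  moreover have "of_nat m *s v + of_nat n *s v \<in> (\<lambda>n. of_nat n *s v) ` A"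
    if "m \<in> A" "n \<in> A" for m n
    using add[OF that] by (rule rev_image_eqI) (simp only: ray_additive)
  ultimately show ?thesis
    unfolding submonoid_add_mon_iff by blast
qed

lemma ray_iso:
  fixes v :: "rat ^ 'p"
  assumes "v \<noteq> 0" and "submonoid A (add_mon UNIV)"
  shows "add_mon ((\<lambda>n. of_nat n *s v) ` A) \<cong> add_mon A"
proof -
  let ?h = "\<lambda>n. of_nat n *s v" and ?k = "the_inv_into A (\<lambda>n. of_nat n *s v)"
  have inj: "inj_on ?h A"
    using ray_inj[OF assms(1)] by (meson inj_on_subset subset_UNIV)
  then have bij: "bij_betw ?k (?h ` A) A"
    by (simp add: bij_betw_the_inv_into inj_on_imp_bij_betw)
  have "?k (?h x + ?h y) = x + y" if "x \<in> A" "y \<in> A" for x y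
  proof -
    have "x + y \<in> A"
      using assms(2) that by (simp add: submonoid_add_mon_iff)
    then show ?thesis
      using the_inv_into_f_f[OF inj, of "x + y"] by (simp only: ray_additive)
  qed
  then have "?k \<in> hom (add_mon (?h ` A)) (add_mon A)"
    by (auto simp: hom_def add_mon_def the_inv_into_f_f[OF inj])
  with bij show ?thesis
    unfolding is_iso_def iso_def by (auto simp: add_mon_def)
qed

section \<open>Natural points of a rational line\<close>

lemma rat_vec_nth [simp]: "rat_vec x $ i = of_nat (x $ i)"
  by (simp add: rat_vec_def)

lemma rat_vec_eq_0_iff [simp]: "rat_vec w = 0 \<longleftrightarrow> w = 0"
  by (simp add: vec_eq_iff)

lemma ray_nat_points: "of_nat n *s rat_vec w \<in> nat_points"
proof -
  have "of_nat n *s rat_vec w = rat_vec (\<chi> i. n * w $ i)"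
    by (simp add: vec_eq_iff)
  then show ?thesis
    by (simp add: nat_points_def)
qed

text \<open>Write the multiplier as a reduced fraction \<open>s / t\<close>. Integrality of \<open>(s / t) w\<close> forces
  \<open>t\<close> to divide every entry of \<open>w\<close>, hence their greatest common divisor.\<close>

lemma line_nat_points:
  fixes w :: "nat ^ 'p"
  assumes "w \<noteq> 0" and "(GCD i\<in>UNIV. w $ i) = 1"
  shows "rat_line (rat_vec w) \<inter> nat_points = range (\<lambda>n. of_nat n *s rat_vec w)"
proof
  show "range (\<lambda>n. of_nat n *s rat_vec w) \<subseteq> rat_line (rat_vec w) \<inter> nat_points"
    using ray_nat_points by (auto simp: rat_line_def)
next
  show "rat_line (rat_vec w) \<inter> nat_points \<subseteq> range (\<lambda>n. of_nat n *s rat_vec w)"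
  proof
    fix v assume "v \<in> rat_line (rat_vec w) \<inter> nat_points"
    then obtain l x where v: "v = l *s rat_vec w" and x: "v = rat_vec x"
      by (auto simp: rat_line_def nat_points_def)
    have lx: "l * of_nat (w $ i) = of_nat (x $ i)" for i
      using arg_cong[OF x[unfolded v], of "\<lambda>v. v $ i"] by simp
    obtain s t where "quotient_of l = (s, t)"
      by fastforce
    then have t: "t > 0" and cop: "coprime t s" and l: "l = of_int s / of_int t"
      by (auto simp: quotient_of_denom_pos quotient_of_coprime quotient_of_div coprime_commute)
    have "nat t dvd w $ i" for i
    proof -
      have "(of_int (s * int (w $ i)) :: rat) = of_int (t * int (x $ i))"
        using lx[of i] t by (simp add: l field_simps)
      then have "s * int (w $ i) = t * int (x $ i)"
        by (simp only: of_int_eq_iff)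
      then have "t dvd int (w $ i)"
        using cop by (metis coprime_dvd_mult_right_iff dvd_triv_left)
      then show ?thesis
        using t by (simp add: nat_dvd_iff)
    qed
    then have "nat t dvd (GCD i\<in>UNIV. w $ i)"
      by (auto intro: Gcd_greatest)
    then have "t = 1"
      using assms(2) t by simp
    with l have ls: "l = of_int s"
      by simp
    obtain i where "w $ i \<noteq> 0"
      using assms(1) by (auto simp: vec_eq_iff)
    moreover have "0 \<le> l * of_nat (w $ i)"
      unfolding lx by simp
    ultimately have "s \<ge> 0"
      by (simp add: ls zero_le_mult_iff)
    then have "v = of_nat (nat s) *s rat_vec w"
      by (simp add: v ls)
    then show "v \<in> range (\<lambda>n. of_nat n *s rat_vec w)"
      by blast
  qed
qed

lemma dist_origin_ray: "dist_origin (of_nat n *s v) = of_nat n * dist_origin v"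
proof -
  have "(\<chi> i. of_rat ((of_nat n *s v) $ i)) = of_nat n *\<^sub>R ((\<chi> i. of_rat (v $ i)) :: real ^ _)"
    by (simp add: vec_eq_iff of_rat_mult)
  then show ?thesis
    by (simp add: dist_origin_def)
qed

lemma dist_origin_pos:
  assumes "v \<noteq> 0"
  shows "dist_origin v > 0"
  using assms by (simp add: dist_origin_def vec_eq_iff)

section \<open>The inequality along a ray\<close>

lemma integer_linear_rat_vec_Ints:
  assumes "integer_linear f"
  shows "f (rat_vec w) \<in> \<int>"
proof -
  interpret Vector_Spaces.linear "(*s)" "(*)" f
    using assms by (simp add: integer_linear_def)
  have "f (rat_vec w) = f (\<Sum>i\<in>UNIV. rat_vec w $ i *s axis i 1)"
    by (simp only: basis_expansion)
  also have "\<dots> = (\<Sum>i\<in>UNIV. of_nat (w $ i) * f (axis i 1))"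
    by (simp add: sum scale)
  also have "\<dots> \<in> \<int>"
    using assms by (intro Ints_sum Ints_mult) (auto simp: integer_linear_def)
  finally show ?thesis .
qed

lemma mod_ineq_on_ray:
  assumes "integer_linear f" and "integer_linear g"
  shows "mod_ineq f g b (of_nat n *s rat_vec w) \<longleftrightarrow>
    int n * \<lfloor>f (rat_vec w)\<rfloor> mod b \<le> int n * \<lfloor>g (rat_vec w)\<rfloor>"
proof -
  have scale: "h (of_nat n *s rat_vec w) = of_int (int n * \<lfloor>h (rat_vec w)\<rfloor>)"
    if h: "integer_linear h" for h
  proof -
    interpret Vector_Spaces.linear "(*s)" "(*)" h
      using h by (simp add: integer_linear_def)
    obtain k where "h (rat_vec w) = of_int k"
      using integer_linear_rat_vec_Ints[OF h, of w] by (rule Ints_cases)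
    then show ?thesis
      by (simp add: scale)
  qed
  show ?thesis
    unfolding mod_ineq_def scale[OF assms(1)] scale[OF assms(2)] floor_of_int
    by (rule of_int_le_iff)
qed

text \<open>Closure under addition is the subadditivity of \<open>x mod b\<close>.\<close>

lemma submonoid_mod_le:
  fixes a b c :: int
  assumes "b > 0"
  shows "submonoid {n. int n * a mod b \<le> int n * c} (add_mon UNIV)"
proof -
  have "int (m + n) * a mod b \<le> int (m + n) * c"
    if "int m * a mod b \<le> int m * c" "int n * a mod b \<le> int n * c" for m n
  proof -
    have "int (m + n) * a mod b = (int m * a mod b + int n * a mod b) mod b"
      by (simp add: distrib_right mod_add_eq)
    also have "\<dots> \<le> int m * a mod b + int n * a mod b"
      using assms by (intro zmod_le_nonneg_dividend) simp
    finally show ?thesis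
      using that by (simp add: distrib_right)
  qed
  then show ?thesis
    by (simp add: submonoid_add_mon_iff)
qed

lemma prop_modular_mod_le:
  fixes a b c :: int
  assumes "b > 0" and "c > 0"
  shows "prop_modular_numerical_semigroup {n. int n * a mod b \<le> int n * c}"
proof -
  \<comment> \<open>Adding \<open>b\<close> keeps the representative positive even when \<open>b\<close> divides \<open>a\<close>.\<close>
  define a' where "a' = nat (a mod b + b)"
  have a': "int a' = a mod b + b"
    using assms(1) by (simp add: a'_def)
  have "a' * n mod nat b \<le> nat c * n \<longleftrightarrow> int n * a mod b \<le> int n * c" for n
  proof -
    have "int (a' * n mod nat b) = (a mod b + b) * int n mod b"
      using assms(1) by (simp add: zmod_int a')
    also have "\<dots> = int n * a mod b"
      by (simp add: distrib_right mod_mult_left_eq mult.commute[of "int n" a])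
    finally have "int (a' * n mod nat b) = int n * a mod b" .
    moreover have "int (nat c * n) = int n * c"
      using assms(2) by simp
    ultimately show ?thesis
      by (simp only: flip: of_nat_le_iff[where 'a = int])
  qed
  then have "{n. int n * a mod b \<le> int n * c} = {n. a' * n mod nat b \<le> nat c * n}"
    by simp
  moreover have "a' > 0" "nat b > 0" "nat c > 0"
    using assms a' by (simp_all add: a'_def add_nonneg_pos)
  ultimately show ?thesis
    unfolding prop_modular_numerical_semigroup_def using submonoid_mod_le[OF assms(1)] by blast
qed

lemma mod_le_zero_iff:
  fixes a b :: int
  assumes "b > 0"
  obtains N :: nat where "N > 0" and "\<And>n. int n * a mod b \<le> 0 \<longleftrightarrow> N dvd n"
proof -
  define d where "d = gcd b a"
  have d: "d > 0"
    using assms by (simp add: d_def)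
  obtain b' a' where b': "b = b' * d" and a': "a = a' * d" and cop: "coprime b' a'"
    using gcd_coprime_exists[of b a] d unfolding d_def by (metis less_irrefl)
  have pos: "nat b' > 0"
    using assms d b' by (simp add: zero_less_mult_iff)
  have "int n * a mod b \<le> 0 \<longleftrightarrow> nat b' dvd n" for n
  proof -
    have "int n * a mod b \<le> 0 \<longleftrightarrow> b dvd int n * a"
      using pos_mod_sign[OF assms, of "int n * a"] by (auto simp: dvd_eq_mod_eq_0)
    also have "\<dots> \<longleftrightarrow> b' * d dvd (int n * a') * d"
      by (simp add: a' b' mult.assoc)
    also have "\<dots> \<longleftrightarrow> b' dvd int n"
      using d cop by (simp add: coprime_dvd_mult_left_iff)
    also have "\<dots> \<longleftrightarrow> nat b' dvd n"
      using pos by (simp add: nat_dvd_iff)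
    finally show ?thesis .
  qed
  with pos show thesis
    by (rule that)
qed

text \<open>The admissible points are the images of the multiples of \<open>N\<close>, and distances are
  proportional to multipliers, so the nearest one has the least positive multiplier.\<close>

lemma is_arg_min_dist_origin_ray:
  fixes v :: "rat ^ 'p"
  assumes "v \<noteq> 0" and "N > 0"
    and P: "\<And>x. P x \<longleftrightarrow> x \<in> (\<lambda>n. of_nat n *s v) ` {n. N dvd n} \<and> x \<noteq> 0"
  shows "is_arg_min dist_origin P u \<longleftrightarrow> u = of_nat N *s v"
proof -
  have nz: "of_nat n *s v \<noteq> 0 \<longleftrightarrow> n > 0" for n
    using injD[OF ray_inj[OF assms(1)], of n 0] by auto
  have P_iff: "P x \<longleftrightarrow> (\<exists>n. x = of_nat n *s v \<and> N dvd n \<and> n > 0)" for x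
    unfolding P image_iff mem_Collect_eq Bex_def using nz by metis
  have less: "dist_origin (of_nat m *s v) < dist_origin (of_nat n *s v) \<longleftrightarrow> m < n" for m n
    using dist_origin_pos[OF assms(1)] by (simp add: dist_origin_ray)
  have PN: "P (of_nat N *s v)"
    unfolding P_iff by (intro exI[of _ N] conjI refl dvd_refl assms(2))
  show ?thesis
  proof
    assume u: "is_arg_min dist_origin P u"
    then obtain n where n: "u = of_nat n *s v" "N dvd n" "n > 0"
      unfolding is_arg_min_def P_iff by blast
    have "\<not> dist_origin (of_nat N *s v) < dist_origin u"
      using u PN unfolding is_arg_min_def by blast
    then have "\<not> N < n"
      by (simp only: n(1) less not_False_eq_True)
    with n(2,3) have "n = N"
      by (auto dest: dvd_imp_le)
    then show "u = of_nat N *s v"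
      by (simp add: n(1))
  next
    assume u: "u = of_nat N *s v"
    have "\<not> dist_origin x < dist_origin (of_nat N *s v)" if "P x" for x
    proof -
      obtain n where n: "x = of_nat n *s v" "N dvd n" "n > 0"
        using \<open>P x\<close> unfolding P_iff by blast
      then show ?thesis
        using dvd_imp_le[of N n] by (simp only: less not_less)
    qed
    with PN show "is_arg_min dist_origin P u"
      unfolding u is_arg_min_def by blast
  qed
qed

section \<open>Rays in the semigroup\<close>

theorem mainTheorem2:
  fixes f g :: "rat ^ 'p \<Rightarrow> rat" and b :: int and w :: "nat ^ 'p"
    and S :: "(rat ^ 'p) set"
  assumes "integer_linear f" and "f \<noteq> (\<lambda>x. 0)"
    and "integer_linear g" and "g \<noteq> (\<lambda>x. 0)"
    and "b > 0"
    and "S = mod_semigroup f g b"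
    and "w \<noteq> 0" and "(GCD i\<in>UNIV. w $ i) = 1"
  shows "(g (rat_vec w) > 0 \<longrightarrow>
      submonoid ({of_nat n *s rat_vec w | n. True} \<inter> S) (add_mon UNIV) \<and>
      (\<exists>T. prop_modular_numerical_semigroup T \<and>
         add_mon ({of_nat n *s rat_vec w | n. True} \<inter> S) \<cong> add_mon T)) \<and>
    (g (rat_vec w) = 0 \<longrightarrow>
      (\<exists>!u. is_arg_min dist_origin
         (\<lambda>v. v \<in> rat_line (rat_vec w) \<inter> nat_points \<and> v \<noteq> 0 \<and> mod_ineq f g b v) u) \<and>
      (\<forall>u. is_arg_min dist_origin
         (\<lambda>v. v \<in> rat_line (rat_vec w) \<inter> nat_points \<and> v \<noteq> 0 \<and> mod_ineq f g b v) u \<longrightarrow>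
         rat_line (rat_vec w) \<inter> S = {of_nat n *s u | n. True} \<and>
         submonoid (rat_line (rat_vec w) \<inter> S) (add_mon UNIV) \<and>
         add_mon (rat_line (rat_vec w) \<inter> S) \<cong> add_mon (UNIV :: nat set)))"
proof -
  let ?r = "\<lambda>n. of_nat n *s rat_vec w"
  let ?P = "\<lambda>v. v \<in> rat_line (rat_vec w) \<inter> nat_points \<and> v \<noteq> 0 \<and> mod_ineq f g b v"
  define F G where "F = \<lfloor>f (rat_vec w)\<rfloor>" and "G = \<lfloor>g (rat_vec w)\<rfloor>"
  define A where "A = {n. int n * F mod b \<le> int n * G}"
  have w: "rat_vec w \<noteq> 0"
    using assms by simp
  have G: "g (rat_vec w) = of_int G"
    using integer_linear_rat_vec_Ints[OF assms(3), of w] by (simp add: G_def)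
  have A: "mod_ineq f g b (?r n) \<longleftrightarrow> n \<in> A" for n
    by (simp add: mod_ineq_on_ray[OF assms(1,3)] A_def F_def G_def)
  have mon: "submonoid A (add_mon UNIV)"
    unfolding A_def by (rule submonoid_mod_le[OF assms(5)])
  have line: "rat_line (rat_vec w) \<inter> nat_points = range ?r"
    by (rule line_nat_points[OF assms(7,8)])
  have rayS: "{?r n | n. True} \<inter> S = ?r ` A"
    using ray_nat_points[of _ w] A by (auto simp: assms(6) mod_semigroup_def)
  have "rat_line (rat_vec w) \<inter> S = {v \<in> range ?r. mod_ineq f g b v}"
    unfolding assms(6) mod_semigroup_def line[symmetric] by blast
  then have lineS: "rat_line (rat_vec w) \<inter> S = ?r ` A"
    using A by auto
  show ?thesis
  proof (intro conjI[of "_ \<longrightarrow> _"] impI)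
    assume "g (rat_vec w) > 0"
    then have "prop_modular_numerical_semigroup A"
      unfolding A_def using prop_modular_mod_le[OF assms(5)] by (simp add: G)
    then show "submonoid ({?r n | n. True} \<inter> S) (add_mon UNIV) \<and>
      (\<exists>T. prop_modular_numerical_semigroup T \<and>
         add_mon ({?r n | n. True} \<inter> S) \<cong> add_mon T)"
      unfolding rayS using submonoid_ray[OF mon] ray_iso[OF w mon] by blast
  next
    assume "g (rat_vec w) = 0"
    then have "G = 0"
      by (simp add: G)
    obtain N where N: "N > 0" and dvd: "\<And>n. int n * F mod b \<le> 0 \<longleftrightarrow> N dvd n"
      using mod_le_zero_iff[OF assms(5)] by blast
    have A_N: "A = {n. N dvd n}"
      using dvd by (simp add: A_def \<open>G = 0\<close>)
    have "?P v \<longleftrightarrow> v \<in> ?r ` {n. N dvd n} \<and> v \<noteq> 0" for v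
      using A by (auto simp: line simp flip: A_N)
    then have min: "is_arg_min dist_origin ?P u \<longleftrightarrow> u = ?r N" for u
      by (rule is_arg_min_dist_origin_ray[OF w N])
    have "?r N \<noteq> 0"
      using w N by (simp add: vec_eq_iff)
    have mult: "?r (N * k) = of_nat k *s ?r N" for k
      by (simp add: vec_eq_iff)
    have "A = range (\<lambda>k. N * k)"
      by (auto simp: A_N)
    then have img: "?r ` A = range (\<lambda>k. of_nat k *s ?r N)"
      by (simp only: image_image mult)
    have "submonoid (UNIV :: nat set) (add_mon UNIV)"
      by (simp add: submonoid_add_mon_iff)
    from ray_iso[OF \<open>?r N \<noteq> 0\<close> this] have iso: "add_mon (?r ` A) \<cong> add_mon (UNIV :: nat set)"
      by (simp only: img)
    have "?r ` A = {of_nat n *s ?r N | n. True}"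
      unfolding img by blast
    with iso show "(\<exists>!u. is_arg_min dist_origin ?P u) \<and>
      (\<forall>u. is_arg_min dist_origin ?P u \<longrightarrow>
         rat_line (rat_vec w) \<inter> S = {of_nat n *s u | n. True} \<and>
         submonoid (rat_line (rat_vec w) \<inter> S) (add_mon UNIV) \<and>
         add_mon (rat_line (rat_vec w) \<inter> S) \<cong> add_mon (UNIV :: nat set))"
      unfolding min lineS using submonoid_ray[OF mon, of "rat_vec w"] by blast
  qed
qed

end
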